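(* Let $X$ be a Banach space and let $T$ be a bounded linear operator on $X$. Then $\chi(T)=\|\widetilde{T}\|$, where $\chi(T)$ is the Hausdorff measure of noncompactness of $T$ and $\widetilde{T}\colon \widehat{X}/X\to\widehat{X}/X$ is the operator induced by $T$ on the quotient of the nonstandard hull $\widehat X$ of $X$ by $X$.
   Context: Measure of noncompactness: for a bounded subset $A$ of a Banach space $X$, $\chi(A)=\inf\{\delta>0 : A \text{ can be covered by finitely many balls of radius } \delta\}$. For a bounded operator $T\colon X\to Y$ with closed unit ball $B_X$ of $X$, $\chi(T)=\chi(TB_X)$. Nonstandard hull: work in a nonstandard universe which is sufficiently saturated (the idealization/saturation principle holds: any family of internal sets indexed by a standard set and having the finite intersection property has nonempty intersection). For a standard set $A$ (or Banach space $X$) let ${}^*A$ (resp. ${}^*X$) be its nonstandard extension; the extension of an operator $T$ is again denoted $T$. Let $\mathrm{fin}({}^*X)$ be the subspace of elements of ${}^*X$ of finite norm and $\mu(0)$ the set of elements of infinitesimal norm. The nonstandard hull of $X$ is the Banach space $\widehat X=\mathrm{fin}({}^*X)/\mu(0)$, with $\|\hat x\|$ the standard part of $\|x\|$, where $\hat x$ is the class of $x\in\mathrm{fin}({}^*X)$. $X$ is identified with a closed subspace of $\widehat X$ via $x\mapsto\hat x$. A bounded operator $T\colon X\to Y$ induces a bounded operator $\widehat T\colon\widehat X\to\widehat Y$, $\widehat T\hat x=\widehat{Tx}$. Quotient: $\widetilde X=\widehat X/X$ with the quotient norm; $\tilde x$ denotes the class of $\hat x$ in $\widetilde X$; $T\colon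 X\to Y$ induces $\widetilde T\colon\widetilde X\to\widetilde Y$ by $\widetilde T\tilde x=\widetilde{Tx}$. *)

theory Defs
  imports "HOL-Analysis.Analysis" "HOL-Algebra.Coset"
begin

section \<open>Hausdorff measure of noncompactness\<close>

definition noncompactness :: "'a::metric_space set \<Rightarrow> real" where
  "noncompactness A =
     Inf {\<delta>. \<delta> > 0 \<and> (\<exists>C. finite C \<and> A \<subseteq> (\<Union>c\<in>C. cball c \<delta>))}"

definition op_noncompactness :: "('a::real_normed_vector \<Rightarrow> 'b::real_normed_vector) \<Rightarrow> real" where
  "op_noncompactness T = noncompactness (T ` cball 0 1)"


section \<open>Nonstandard universes\<close>

text \<open>
  The standard universe over a type of individuals consists of the individuals and the sets of
  individuals. Every finitary relation on it, given as a set of tuples (lists), is a symbol of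
  the first-order language in which transfer is formulated.
\<close>

datatype 'u entity = Ind 'u | Cls "'u set"

datatype 'v fm =
    Rel "'v list set" "nat list"
  | Eq nat nat
  | Neg "'v fm"
  | Conj "'v fm" "'v fm"
  | All nat "'v fm"

text \<open>
  Satisfaction in a structure of type \<open>'w\<close> that interprets the symbol \<open>R\<close> as \<open>I R\<close>, under the
  assignment \<open>e\<close> of the variables.
\<close>

primrec sat :: "('v list set \<Rightarrow> 'w list set) \<Rightarrow> 'v fm \<Rightarrow> (nat \<Rightarrow> 'w) \<Rightarrow> bool" where
  "sat I (Rel R xs) e \<longleftrightarrow> map e xs \<in> I R"
| "sat I (Eq x y) e \<longleftrightarrow> e x = e y"
| "sat I (Neg p) e \<longleftrightarrow> \<not> sat I p e"
| "sat I (Conj p q) e \<longleftrightarrow> sat I p e \<and> sat I q e"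
| "sat I (All x p) e \<longleftrightarrow> (\<forall>a. sat I p (e(x := a)))"

text \<open>
  The type \<open>'s\<close> is that of the internal entities; \<open>star\<close> sends a standard entity, and \<open>ext\<close> a
  standard relation, to its nonstandard extension. Any nonstandard universe over a larger
  superstructure (an ultrapower or not) restricts to one of this kind, with \<open>'s\<close> the extension of
  the set of all individuals and all sets of individuals.
\<close>

record ('u, 's) universe =
  star :: "'u entity \<Rightarrow> 's"
  ext :: "'u entity list set \<Rightarrow> 's list set"

definition transfer_principle :: "('u, 's) universe \<Rightarrow> bool" where
  "transfer_principle N \<longleftrightarrow>
     (\<forall>p e. sat (\<lambda>R. R) p e \<longleftrightarrow> sat (ext N) p (\<lambda>i. star N (e i)))"

text \<open>
  The internal sets (of individuals) are the sets coded by the elements of the extension of the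
  power set of the individuals, by means of the extension of the membership relation.
\<close>

definition internal :: "('u, 's) universe \<Rightarrow> 's set \<Rightarrow> bool" where
  "internal N A \<longleftrightarrow>
     (\<exists>s. [s] \<in> ext N {[Cls B] | B. True} \<and> A = {x. [x, s] \<in> ext N {[Ind u, Cls B] | u B. u \<in> B}})"

definition saturated :: "('u, 's) universe \<Rightarrow> bool" where
  "saturated N \<longleftrightarrow>
     (\<forall>(J :: 'u entity set) A.
        (\<forall>j\<in>J. internal N (A j)) \<longrightarrow>
        (\<forall>F. finite F \<and> F \<subseteq> J \<longrightarrow> (\<Inter>j\<in>F. A j) \<noteq> {}) \<longrightarrow>
        (\<Inter>j\<in>J. A j) \<noteq> {})"

definition saturated_nonstandard_universe :: "('u, 's) universe \<Rightarrow> bool" where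
  "saturated_nonstandard_universe N \<longleftrightarrow> transfer_principle N \<and> saturated N"

text \<open>
  Extension of a standard function, given by its graph (arguments first, value last). By transfer
  the described value exists and is unique whenever the arguments lie in the extension of the
  domain.
\<close>

definition fun_ext :: "('u, 's) universe \<Rightarrow> 'u entity list set \<Rightarrow> 's list \<Rightarrow> 's" where
  "fun_ext N G xs = (THE y. xs @ [y] \<in> ext N G)"


section \<open>The nonstandard hull\<close>

text \<open>
  From here on the individuals are the vectors of the space \<open>'a\<close> and the real numbers.
\<close>

abbreviation vec_ent :: "'a \<Rightarrow> ('a + real) entity" where
  "vec_ent v \<equiv> Ind (Inl v)"

abbreviation num_ent :: "real \<Rightarrow> ('a + real) entity" where
  "num_ent r \<equiv> Ind (Inr r)"

definition ns_space :: "('a + real, 's) universe \<Rightarrow> 's set" where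
  "ns_space N = {x. [x] \<in> ext N {[vec_ent v] | v. True}}"

definition ns_add :: "('a::real_normed_vector + real, 's) universe \<Rightarrow> 's \<Rightarrow> 's \<Rightarrow> 's" where
  "ns_add N x y = fun_ext N {[vec_ent u, vec_ent v, vec_ent (u + v)] | u v. True} [x, y]"

definition ns_norm :: "('a::real_normed_vector + real, 's) universe \<Rightarrow> 's \<Rightarrow> 's" where
  "ns_norm N x = fun_ext N {[vec_ent v, num_ent (norm v)] | v. True} [x]"

definition ns_op :: "('a + real, 's) universe \<Rightarrow> ('a \<Rightarrow> 'a) \<Rightarrow> 's \<Rightarrow> 's" where
  "ns_op N T x = fun_ext N {[vec_ent v, vec_ent (T v)] | v. True} [x]"

definition ns_less :: "('a + real, 's) universe \<Rightarrow> 's \<Rightarrow> 's \<Rightarrow> bool" where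
  "ns_less N s t \<longleftrightarrow> [s, t] \<in> ext N {[num_ent a, num_ent b] | a b. a < b}"

definition standard_part :: "('a + real, 's) universe \<Rightarrow> 's \<Rightarrow> real" where
  "standard_part N t =
     (THE r. \<forall>\<epsilon>>0. ns_less N (star N (num_ent (r - \<epsilon>))) t \<and> ns_less N t (star N (num_ent (r + \<epsilon>))))"

definition ns_fin :: "('a::real_normed_vector + real, 's) universe \<Rightarrow> 's set" where
  "ns_fin N = {x \<in> ns_space N. \<exists>r. ns_less N (ns_norm N x) (star N (num_ent r))}"

definition monad0 :: "('a::real_normed_vector + real, 's) universe \<Rightarrow> 's set" where
  "monad0 N = {x \<in> ns_space N. \<forall>r>0. ns_less N (ns_norm N x) (star N (num_ent r))}"

text \<open>
  The underlying additive groups of the spaces are written as (multiplicative) group records, so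
  that quotients are those of \<^theory>\<open>HOL-Algebra.Coset\<close>; their elements are cosets.
\<close>

definition fin_group :: "('a::real_normed_vector + real, 's) universe \<Rightarrow> 's monoid" where
  "fin_group N = \<lparr>carrier = ns_fin N, monoid.mult = ns_add N, one = star N (vec_ent 0)\<rparr>"

definition ns_hull :: "('a::real_normed_vector + real, 's) universe \<Rightarrow> 's set monoid" where
  "ns_hull N = fin_group N Mod monad0 N"

definition hat :: "('a::real_normed_vector + real, 's) universe \<Rightarrow> 's \<Rightarrow> 's set" where
  "hat N x = monad0 N #>\<^bsub>fin_group N\<^esub> x"

text \<open>
  Maps on a quotient that are induced by a map \<open>f\<close> on representatives are written
  \<open>\<lambda>\<xi>. the_elem (f ` \<xi>)\<close>: \<open>f\<close> is constant on each coset.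
\<close>

definition hull_norm :: "('a::real_normed_vector + real, 's) universe \<Rightarrow> 's set \<Rightarrow> real" where
  "hull_norm N \<xi> = the_elem ((\<lambda>x. standard_part N (ns_norm N x)) ` \<xi>)"

definition hull_op ::
    "('a::real_normed_vector + real, 's) universe \<Rightarrow> ('a \<Rightarrow> 'a) \<Rightarrow> 's set \<Rightarrow> 's set" where
  "hull_op N T \<xi> = the_elem ((\<lambda>x. hat N (ns_op N T x)) ` \<xi>)"


section \<open>The quotient of the nonstandard hull by the space\<close>

definition std_copy :: "('a::real_normed_vector + real, 's) universe \<Rightarrow> 's set set" where
  "std_copy N = range (\<lambda>v. hat N (star N (vec_ent v)))"

definition hull_quot :: "('a::real_normed_vector + real, 's) universe \<Rightarrow> 's set set monoid" where
  "hull_quot N = ns_hull N Mod std_copy N"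

definition quot_norm :: "('a::real_normed_vector + real, 's) universe \<Rightarrow> 's set set \<Rightarrow> real" where
  "quot_norm N c = (INF \<xi>\<in>c. hull_norm N \<xi>)"

definition quot_op ::
    "('a::real_normed_vector + real, 's) universe \<Rightarrow> ('a \<Rightarrow> 'a) \<Rightarrow> 's set set \<Rightarrow> 's set set" where
  "quot_op N T c = the_elem ((\<lambda>\<xi>. std_copy N #>\<^bsub>ns_hull N\<^esub> hull_op N T \<xi>) ` c)"

definition quot_opnorm ::
    "('a::real_normed_vector + real, 's) universe \<Rightarrow> ('s set set \<Rightarrow> 's set set) \<Rightarrow> real" where
  "quot_opnorm N S = (SUP c\<in>{c \<in> carrier (hull_quot N). quot_norm N c \<le> 1}. quot_norm N (S c))"

end

theory Submission imports Defs begin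

text \<open>
  Both inequalities come from reading \<open>dist (T x) c \<le> \<delta>\<close> in the nonstandard universe. If finitely many
  balls \<open>cball c \<delta>\<close> cover the image of the unit ball, then by transfer, since the extension of a finite
  union is the union of the extensions, every \<open>T x\<close> with \<open>x\<close> in the extended unit ball lies within \<open>\<delta>\<close>
  of a standard point; so the quotient norm of the image is at most \<open>\<delta>\<close>. If no finite family of such
  balls covers, the sets of \<open>v\<close> in the unit ball with \<open>dist (T v) c > \<delta>\<close>, for standard \<open>c\<close>, have the finite
  intersection property, and saturation gives one internal \<open>x\<close> with \<open>T x\<close> at distance at least \<open>\<delta>\<close>
  from all standard points.
\<close>

section \<open>Transfer\<close>

abbreviation fm_imp :: "'v fm \<Rightarrow> 'v fm \<Rightarrow> 'v fm" where
  "fm_imp p q \<equiv> Neg (Conj p (Neg q))"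

abbreviation fm_ex :: "nat \<Rightarrow> 'v fm \<Rightarrow> 'v fm" where
  "fm_ex x p \<equiv> Neg (All x (Neg p))"

abbreviation vec_rel :: "'a set \<Rightarrow> ('a + real) entity list set" where
  "vec_rel A \<equiv> {[vec_ent v] | v. v \<in> A}"

text \<open>A relation symbol is the standard relation itself, so this graph and the three relations
  below repeat the sets that occur in \<open>ns_op\<close>, \<open>ns_add\<close>,
  \<open>ns_norm\<close> and \<open>ns_less\<close>.\<close>

abbreviation fun_graph :: "('a \<Rightarrow> 'a) \<Rightarrow> ('a + real) entity list set" where
  "fun_graph f \<equiv> {[vec_ent v, vec_ent (f v)] | v. True}"

abbreviation add_graph :: "('a::real_normed_vector + real) entity list set" where
  "add_graph \<equiv> {[vec_ent u, vec_ent v, vec_ent (u + v)] | u v. True}"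

abbreviation norm_graph :: "('a::real_normed_vector + real) entity list set" where
  "norm_graph \<equiv> {[vec_ent v, num_ent (norm v)] | v. True}"

abbreviation less_rel :: "('a + real) entity list set" where
  "less_rel \<equiv> {[num_ent a, num_ent b] | a b. a < b}"

locale nonstandard_hull =
  fixes N :: "('a::real_normed_vector + real, 's) universe"
  assumes saturated_nonstandard: "saturated_nonstandard_universe N"
begin

lemma transfer: "sat (\<lambda>R. R) p e \<longleftrightarrow> sat (ext N) p (\<lambda>i. star N (e i))"
  using saturated_nonstandard
  unfolding saturated_nonstandard_universe_def transfer_principle_def by blast

lemma transferD: "sat (\<lambda>R. R) p e \<Longrightarrow> sat (ext N) p (\<lambda>i. star N (e i))"
  by (simp only: transfer)

text \<open>The nonstandard extension of \<open>A\<close>. Norm estimates are phrased below as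
  membership in extensions of balls, which avoids arithmetic with nonstandard reals.\<close>

definition star_set :: "'a set \<Rightarrow> 's set" where
  "star_set A = {x. [x] \<in> ext N (vec_rel A)}"

abbreviation emb :: "'a \<Rightarrow> 's" where
  "emb v \<equiv> star N (vec_ent v)"

lemma ns_space_eq: "ns_space N = star_set UNIV"
  by (simp add: ns_space_def star_set_def)

lemma emb_in_star_set_iff [simp]: "emb v \<in> star_set A \<longleftrightarrow> v \<in> A"
  using transfer[of "Rel (vec_rel A) [0]" "\<lambda>_. vec_ent v"] by (auto simp: star_set_def)

lemma star_set_mono: "A \<subseteq> B \<Longrightarrow> star_set A \<subseteq> star_set B"
  \<comment> \<open>The sentence is closed, so the assignment \<open>undefined\<close> is a dummy;
    the same holds wherever it appears below.\<close>
  using transfer[of "All 0 (fm_imp (Rel (vec_rel A) [0]) (Rel (vec_rel B) [0]))" undefined]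
  by (auto simp: star_set_def)

lemma star_set_space: "x \<in> star_set A \<Longrightarrow> x \<in> ns_space N"
  using star_set_mono[of A UNIV] by (auto simp: ns_space_eq)

lemma star_set_disjoint: "A \<inter> B = {} \<Longrightarrow> x \<in> star_set A \<Longrightarrow> x \<notin> star_set B"
  using transfer[of "All 0 (fm_imp (Rel (vec_rel A) [0]) (Neg (Rel (vec_rel B) [0])))" undefined]
  by (auto simp: star_set_def)

lemma star_set_empty: "star_set {} = {}"
  using star_set_disjoint[of "{}" "{}"] by auto

lemma star_set_Un: "star_set (A \<union> B) \<subseteq> star_set A \<union> star_set B"
  using transfer[of "All 0 (fm_imp (Rel (vec_rel (A \<union> B)) [0])
      (fm_imp (Neg (Rel (vec_rel A) [0])) (Rel (vec_rel B) [0])))" undefined]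
  by (auto simp: star_set_def)

text \<open>An extended infinite union may contain points outside every extended member; this is
  where finiteness of a cover enters.\<close>

lemma star_set_UN: "finite C \<Longrightarrow> star_set (\<Union>c\<in>C. A c) \<subseteq> (\<Union>c\<in>C. star_set (A c))"
proof (induction C rule: finite_induct)
  case empty
  then show ?case by (simp add: star_set_empty)
next
  case (insert c C)
  then show ?case using star_set_Un[of "A c" "\<Union>c\<in>C. A c"] by auto
qed

lemma star_set_cases: "x \<in> ns_space N \<Longrightarrow> x \<in> star_set A \<or> x \<in> star_set (- A)"
  using star_set_Un[of A "- A"] by (auto simp: ns_space_eq)

text \<open>Totality and single-valuedness of the graph both transfer, so the description in
  \<open>fun_ext\<close> has a unique solution. A general \<open>g\<close> covers vector values and
  real values at once.\<close>

lemma fun_ext_unary: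
  fixes g :: "'a \<Rightarrow> ('a + real) entity"
  assumes "x \<in> ns_space N"
  shows "[x, fun_ext N {[vec_ent v, g v] | v. True} [x]] \<in> ext N {[vec_ent v, g v] | v. True}"
proof -
  let ?G = "{[vec_ent v, g v] | v. True}"
  have "\<exists>y. [x, y] \<in> ext N ?G"
    using assms transfer[of "All 0 (fm_imp (Rel (vec_rel UNIV) [0]) (fm_ex 1 (Rel ?G [0, 1])))" undefined]
    by (auto simp: ns_space_def)
  moreover have "y = z" if "[x, y] \<in> ext N ?G" "[x, z] \<in> ext N ?G" for y z
    using that transfer[of "All 0 (All 1 (All 2 (fm_imp (Rel ?G [0, 1]) (fm_imp (Rel ?G [0, 2]) (Eq 1 2)))))" undefined]
    by auto
  ultimately have "\<exists>!y. [x, y] \<in> ext N ?G" by blast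
  then show ?thesis
    unfolding fun_ext_def by (metis (no_types, lifting) append_Cons append_Nil theI')
qed

lemma ns_op_graph: "x \<in> ns_space N \<Longrightarrow> [x, ns_op N f x] \<in> ext N (fun_graph f)"
  unfolding ns_op_def by (rule fun_ext_unary)

lemma ns_norm_graph: "x \<in> ns_space N \<Longrightarrow> [x, ns_norm N x] \<in> ext N norm_graph"
  unfolding ns_norm_def by (rule fun_ext_unary)

text \<open>Extension commutes with preimages, so claims about extended maps reduce to relations
  between standard sets.\<close>

lemma ns_op_star_set_iff:
  assumes "x \<in> ns_space N"
  shows "ns_op N f x \<in> star_set A \<longleftrightarrow> x \<in> star_set (f -` A)"
  using ns_op_graph[OF assms, of f]
    transfer[of "All 0 (All 1 (fm_imp (Rel (fun_graph f) [0, 1])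
      (fm_imp (Rel (vec_rel A) [1]) (Rel (vec_rel (f -` A)) [0]))))" undefined]
    transfer[of "All 0 (All 1 (fm_imp (Rel (fun_graph f) [0, 1])
      (fm_imp (Rel (vec_rel (f -` A)) [0]) (Rel (vec_rel A) [1]))))" undefined]
  by (auto simp: star_set_def)

lemma ns_op_closed: "x \<in> ns_space N \<Longrightarrow> ns_op N f x \<in> ns_space N"
  using ns_op_star_set_iff[of x f UNIV] by (simp add: ns_space_eq)

section \<open>Addition on the extended space\<close>

lemma add_graph_unique:
  "[x, y, z] \<in> ext N add_graph \<Longrightarrow> [x, y, z'] \<in> ext N add_graph \<Longrightarrow> z = z'"
  using transfer[of "All 0 (All 1 (All 2 (All 3 (fm_imp (Rel add_graph [0, 1, 2])
    (fm_imp (Rel add_graph [0, 1, 3]) (Eq 2 3))))))" undefined]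
  by auto

lemma ns_add_graph:
  assumes "x \<in> ns_space N" "y \<in> ns_space N"
  shows "[x, y, ns_add N x y] \<in> ext N add_graph"
proof -
  have "\<exists>z. [x, y, z] \<in> ext N add_graph"
    using assms transfer[of "All 0 (All 1 (fm_imp (Rel (vec_rel UNIV) [0])
      (fm_imp (Rel (vec_rel UNIV) [1]) (fm_ex 2 (Rel add_graph [0, 1, 2])))))" undefined]
    by (auto simp: ns_space_def)
  then have "\<exists>!z. [x, y, z] \<in> ext N add_graph" using add_graph_unique by blast
  then show ?thesis
    unfolding ns_add_def fun_ext_def by (metis (no_types, lifting) append_Cons append_Nil theI')
qed

lemma ns_add_eqI:
  "x \<in> ns_space N \<Longrightarrow> y \<in> ns_space N \<Longrightarrow> [x, y, z] \<in> ext N add_graph \<Longrightarrow> ns_add N x y = z"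
  using add_graph_unique ns_add_graph by blast

lemma ns_add_star_set:
  assumes "x \<in> star_set A" "y \<in> star_set B" "\<And>a b. a \<in> A \<Longrightarrow> b \<in> B \<Longrightarrow> a + b \<in> C"
  shows "ns_add N x y \<in> star_set C"
  using ns_add_graph[OF star_set_space[OF assms(1)] star_set_space[OF assms(2)]] assms
    transfer[of "All 0 (All 1 (All 2 (fm_imp (Rel add_graph [0, 1, 2])
      (fm_imp (Rel (vec_rel A) [0]) (fm_imp (Rel (vec_rel B) [1]) (Rel (vec_rel C) [2]))))))" undefined]
  by (fastforce simp: star_set_def)

lemma ns_add_closed: "x \<in> ns_space N \<Longrightarrow> y \<in> ns_space N \<Longrightarrow> ns_add N x y \<in> ns_space N"
  using ns_add_star_set[of x UNIV y UNIV UNIV] by (simp add: ns_space_eq)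

lemma ns_add_commute:
  assumes "x \<in> ns_space N" "y \<in> ns_space N"
  shows "ns_add N x y = ns_add N y x"
  using ns_add_graph[OF assms(2,1)] assms
    transfer[of "All 0 (All 1 (All 2 (fm_imp (Rel add_graph [0, 1, 2]) (Rel add_graph [1, 0, 2]))))" undefined]
  by (intro ns_add_eqI) (auto simp: add.commute)

lemma ns_add_assoc:
  assumes "x \<in> ns_space N" "y \<in> ns_space N" "z \<in> ns_space N"
  shows "ns_add N (ns_add N x y) z = ns_add N x (ns_add N y z)"
proof -
  \<comment> \<open>Naming the graph keeps it an opaque symbol while the transferred sentence is
    simplified.\<close>
  define G :: "('a + real) entity list set" where "G = add_graph"
  \<comment> \<open>Variables 0, 1, 3 are the summands, 2 and 5 the inner sums, 4 the total.\<close>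
  let ?p = "All 0 (All 1 (All 2 (All 3 (All 4 (All 5 (fm_imp (Rel G [0, 1, 2])
    (fm_imp (Rel G [2, 3, 4]) (fm_imp (Rel G [1, 3, 5]) (Rel G [0, 5, 4])))))))))"
  have "sat (\<lambda>R. R) ?p undefined" by (auto simp: G_def add.assoc)
  from transferD[OF this, simplified] have *: "\<And>x y a z b c. [x, y, a] \<in> ext N G \<Longrightarrow>
      [a, z, b] \<in> ext N G \<Longrightarrow> [y, z, c] \<in> ext N G \<Longrightarrow> [x, c, b] \<in> ext N G"
    by blast
  have "[x, ns_add N y z, ns_add N (ns_add N x y) z] \<in> ext N G"
    using ns_add_graph[OF assms(1,2)] ns_add_graph[OF ns_add_closed[OF assms(1,2)] assms(3)]
      ns_add_graph[OF assms(2,3)] unfolding G_def[symmetric] by (rule * )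
  from ns_add_eqI[OF assms(1) ns_add_closed[OF assms(2,3)] this[unfolded G_def]]
  show ?thesis by (rule sym)
qed

text \<open>Translation by a standard vector is the extension of a standard map, so
  \<open>ns_op_star_set_iff\<close> applies to it. The free variable 2 of the formula stands for
  \<open>v\<close>.\<close>

lemma ns_add_emb: "x \<in> ns_space N \<Longrightarrow> ns_add N (emb v) x = ns_op N (\<lambda>u. v + u) x"
  using ns_op_graph[of x "\<lambda>u. v + u"]
    transfer[of "All 0 (All 1 (fm_imp (Rel (fun_graph (\<lambda>u. v + u)) [0, 1]) (Rel add_graph [2, 0, 1])))"
      "\<lambda>_. vec_ent v"]
  by (intro ns_add_eqI) (auto simp: ns_space_eq)

lemma ns_op_emb: "ns_op N f (emb v) = emb (f v)"
proof -
  have "emb v \<in> ns_space N" by (simp add: ns_space_eq)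
  from ns_op_graph[OF this, of f]
  show ?thesis
    using transfer[of "All 0 (fm_imp (Rel (fun_graph f) [1, 0]) (Eq 0 2))"
       "\<lambda>i. if i = 1 then vec_ent v else vec_ent (f v)"]
    by auto
qed

lemma ns_add_emb_emb: "ns_add N (emb u) (emb v) = emb (u + v)"
  by (simp add: ns_add_emb ns_op_emb ns_space_eq)

lemma ns_op_id:
  assumes "x \<in> ns_space N"
  shows "ns_op N (\<lambda>u. u) x = x"
  using ns_op_graph[OF assms, of "\<lambda>u. u"]
    transfer[of "All 0 (All 1 (fm_imp (Rel (fun_graph (\<lambda>u. u)) [0, 1]) (Eq 1 0)))" undefined]
  by auto

lemma ns_add_zero: "x \<in> ns_space N \<Longrightarrow> ns_add N (emb 0) x = x"
  by (simp add: ns_add_emb ns_op_id)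

lemma ns_add_minus:
  assumes "x \<in> ns_space N"
  shows "ns_add N (ns_op N uminus x) x = emb 0"
proof -
  have "[ns_op N uminus x, x, emb 0] \<in> ext N add_graph"
    using ns_op_graph[OF assms, of uminus]
      transfer[of "All 0 (All 1 (fm_imp (Rel (fun_graph uminus) [0, 1]) (Rel add_graph [1, 0, 2])))"
        "\<lambda>_. vec_ent 0"]
    by auto
  then show ?thesis using assms by (intro ns_add_eqI ns_op_closed)
qed

lemma ns_op_add:
  assumes "\<And>u v. f (u + v) = f u + f v" "x \<in> ns_space N" "y \<in> ns_space N"
  shows "ns_op N f (ns_add N x y) = ns_add N (ns_op N f x) (ns_op N f y)"
proof -
  define G :: "('a + real) entity list set" where "G = add_graph"
  define H where "H = fun_graph f"
  let ?p = "All 0 (All 1 (All 2 (All 3 (All 4 (All 5 (fm_imp (Rel G [0, 1, 2])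
    (fm_imp (Rel H [0, 3]) (fm_imp (Rel H [1, 4]) (fm_imp (Rel H [2, 5]) (Rel G [3, 4, 5]))))))))))"
  have "sat (\<lambda>R. R) ?p undefined" by (auto simp: G_def H_def assms(1))
  from transferD[OF this, simplified] have *: "\<And>x y z x' y' z'. [x, y, z] \<in> ext N G \<Longrightarrow>
      [x, x'] \<in> ext N H \<Longrightarrow> [y, y'] \<in> ext N H \<Longrightarrow> [z, z'] \<in> ext N H \<Longrightarrow> [x', y', z'] \<in> ext N G"
    by blast
  have "[ns_op N f x, ns_op N f y, ns_op N f (ns_add N x y)] \<in> ext N G"
    using ns_add_graph[OF assms(2,3)] ns_op_graph[OF assms(2), of f] ns_op_graph[OF assms(3), of f]
      ns_op_graph[OF ns_add_closed[OF assms(2,3)], of f]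
    unfolding G_def[symmetric] H_def[symmetric] by (rule * )
  from ns_add_eqI[OF ns_op_closed[OF assms(2)] ns_op_closed[OF assms(3)] this[unfolded G_def]]
  show ?thesis by (rule sym)
qed

section \<open>Comparison of norms with standard reals\<close>

lemma ns_norm_less_iff:
  assumes "x \<in> ns_space N"
  shows "ns_less N (ns_norm N x) (star N (num_ent r)) \<longleftrightarrow> x \<in> star_set (ball 0 r)"
  using ns_norm_graph[OF assms]
    transfer[of "All 0 (All 1 (fm_imp (Rel norm_graph [0, 1])
      (fm_imp (Rel less_rel [1, 2]) (Rel (vec_rel (ball 0 r)) [0]))))" "\<lambda>_. num_ent r"]
    transfer[of "All 0 (All 1 (fm_imp (Rel norm_graph [0, 1])
      (fm_imp (Rel (vec_rel (ball 0 r)) [0]) (Rel less_rel [1, 2]))))" "\<lambda>_. num_ent r"]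
  by (auto simp: star_set_def ns_less_def)

lemma ns_norm_greater_iff:
  assumes "x \<in> ns_space N"
  shows "ns_less N (star N (num_ent r)) (ns_norm N x) \<longleftrightarrow> x \<in> star_set (- cball 0 r)"
  using ns_norm_graph[OF assms]
    transfer[of "All 0 (All 1 (fm_imp (Rel norm_graph [0, 1])
      (fm_imp (Rel less_rel [2, 1]) (Rel (vec_rel (- cball 0 r)) [0]))))" "\<lambda>_. num_ent r"]
    transfer[of "All 0 (All 1 (fm_imp (Rel norm_graph [0, 1])
      (fm_imp (Rel (vec_rel (- cball 0 r)) [0]) (Rel less_rel [2, 1]))))" "\<lambda>_. num_ent r"]
  by (auto simp: star_set_def ns_less_def)

text \<open>Standard sets have internal extensions, and a standard point of a finite intersection
  lies in all the extensions concerned; so the finite intersection property need only be checked on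
  standard sets.\<close>

lemma saturation:
  fixes A :: "'a \<Rightarrow> 'a set"
  assumes "\<And>C. finite C \<Longrightarrow> (\<Inter>c\<in>C. A c) \<noteq> {}"
  shows "(\<Inter>c. star_set (A c)) \<noteq> {}"
proof -
  define B :: "('a + real) entity \<Rightarrow> ('a + real) set"
    \<comment> \<open>Saturation is indexed by entities, so the choice operator recovers the vector
      from \<open>j\<close>; values outside \<open>range vec_ent\<close> are irrelevant.\<close>
    where "B j = Inl ` A (SOME v. j = vec_ent v)" for j
  let ?mem = "{[Ind u, Cls B] | u B. u \<in> B} :: ('a + real) entity list set"
  define S where "S j = {x. [x, star N (Cls (B j))] \<in> ext N ?mem}" for j
  have S: "S (vec_ent c) = star_set (A c)" for c
    using
      transfer[of "All 0 (fm_imp (Rel ?mem [0, 1]) (Rel (vec_rel (A c)) [0]))" "\<lambda>_. Cls (B (vec_ent c))"]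
      transfer[of "All 0 (fm_imp (Rel (vec_rel (A c)) [0]) (Rel ?mem [0, 1]))" "\<lambda>_. Cls (B (vec_ent c))"]
    by (auto simp: S_def B_def star_set_def)
  have "internal N (S j)" for j
    using transfer[of "Rel {[Cls B] | B. True} [0]" "\<lambda>_. Cls (B j)"]
    unfolding internal_def S_def by auto
  moreover have "(\<Inter>j\<in>F. S j) \<noteq> {}" if F: "finite F \<and> F \<subseteq> range vec_ent" for F
  proof -
    obtain C where C: "finite C" "F = vec_ent ` C"
      using F finite_subset_image[of F vec_ent UNIV] by metis
    obtain v where "v \<in> (\<Inter>c\<in>C. A c)" using assms[OF C(1)] by blast
    then have "emb v \<in> (\<Inter>j\<in>F. S j)" by (auto simp: C S)
    then show ?thesis by blast
  qed
  ultimately have "(\<Inter>j\<in>range vec_ent. S j) \<noteq> {}"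
    using saturated_nonstandard unfolding saturated_nonstandard_universe_def saturated_def by blast
  then show ?thesis by (simp add: S)
qed

section \<open>The nonstandard hull\<close>

lemma star_set_ball_pos: "x \<in> star_set (ball 0 r) \<Longrightarrow> 0 < r"
  by (rule ccontr) (simp add: not_less ball_empty star_set_empty)

lemma ns_fin_iff: "x \<in> ns_fin N \<longleftrightarrow> (\<exists>r. x \<in> star_set (ball 0 r))"
  unfolding ns_fin_def using ns_norm_less_iff star_set_space by blast

lemma monad0_iff: "x \<in> monad0 N \<longleftrightarrow> (\<forall>r>0. x \<in> star_set (ball 0 r))"
  unfolding monad0_def using ns_norm_less_iff star_set_space zero_less_one by blast

lemma ns_fin_space: "x \<in> ns_fin N \<Longrightarrow> x \<in> ns_space N"
  by (simp add: ns_fin_def)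

lemma monad0_fin: "x \<in> monad0 N \<Longrightarrow> x \<in> ns_fin N"
  unfolding monad0_iff ns_fin_iff using zero_less_one by blast

lemma emb_fin: "emb v \<in> ns_fin N"
  unfolding ns_fin_iff by (rule exI[of _ "norm v + 1"]) simp

text \<open>For finite \<open>x\<close> this is the standard part of the norm, written without
  nonstandard reals; \<open>standard_part_ns_norm\<close> proves the agreement.\<close>

definition std_norm :: "'s \<Rightarrow> real" where
  "std_norm x = Inf {r. x \<in> star_set (ball 0 r)}"

lemma std_norm_le: "x \<in> star_set (ball 0 r) \<Longrightarrow> std_norm x \<le> r"
  unfolding std_norm_def
  by (rule cInf_lower) (auto intro!: bdd_belowI[of _ 0] dest!: star_set_ball_pos)

lemma std_norm_less:
  assumes "x \<in> ns_fin N" "std_norm x < r"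
  shows "x \<in> star_set (ball 0 r)"
proof -
  obtain s where "x \<in> star_set (ball 0 s)" "s < r"
    using cInf_lessD[OF _ assms(2)[unfolded std_norm_def]] assms(1) by (auto simp: ns_fin_iff)
  then show ?thesis using star_set_mono[OF subset_ball[of s r 0]] by auto
qed

lemma std_norm_nonneg: "x \<in> ns_fin N \<Longrightarrow> 0 \<le> std_norm x"
  unfolding std_norm_def by (rule cInf_greatest) (auto simp: ns_fin_iff dest!: star_set_ball_pos)

lemma standard_part_ns_norm:
  assumes "x \<in> ns_fin N"
  shows "standard_part N (ns_norm N x) = std_norm x"
  unfolding standard_part_def ns_norm_less_iff[OF ns_fin_space[OF assms]]
    ns_norm_greater_iff[OF ns_fin_space[OF assms]]
proof (rule the_equality; (intro allI impI)?)
  fix e :: real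
  assume e: "0 < e"
  \<comment> \<open>Half of \<open>e\<close> is kept in reserve to pass from the complement of an
    open ball to that of a smaller closed ball.\<close>
  have "x \<notin> star_set (ball 0 (std_norm x - e / 2))"
    using std_norm_le[of x "std_norm x - e / 2"] e by linarith
  then have "x \<in> star_set (- ball 0 (std_norm x - e / 2))"
    using star_set_cases ns_fin_space[OF assms] by blast
  moreover have "- ball 0 (std_norm x - e / 2) \<subseteq> - cball 0 (std_norm x - e)"
    using e by auto
  ultimately have "x \<in> star_set (- cball 0 (std_norm x - e))"
    using star_set_mono by blast
  then show "x \<in> star_set (- cball 0 (std_norm x - e)) \<and> x \<in> star_set (ball 0 (std_norm x + e))"
    using std_norm_less[OF assms] e by simp
next
  fix r
  assume r: "\<forall>e>0. x \<in> star_set (- cball 0 (r - e)) \<and> x \<in> star_set (ball 0 (r + e))"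
  have "std_norm x \<le> r"
    using r std_norm_le field_le_epsilon by blast
  moreover have "r \<le> std_norm x"
  proof (rule ccontr)
    assume "\<not> r \<le> std_norm x"
    \<comment> \<open>The radius used next is the midpoint of \<open>std_norm x\<close> and
      \<open>r\<close>, which \<open>x\<close> would both exceed and stay below.\<close>
    then have "0 < (r - std_norm x) / 2" by simp
    with r have "x \<in> star_set (- cball 0 (r - (r - std_norm x) / 2))" by blast
    moreover have "x \<in> star_set (ball 0 (r - (r - std_norm x) / 2))"
      using \<open>\<not> r \<le> std_norm x\<close> by (intro std_norm_less[OF assms]) (simp add: field_simps)
    moreover have "- cball 0 (r - (r - std_norm x) / 2) \<inter> ball (0::'a) (r - (r - std_norm x) / 2) = {}"
      by auto
    ultimately show False using star_set_disjoint by blast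
  qed
  ultimately show "r = std_norm x" by simp
qed

section \<open>The groups of finite and of infinitesimal points\<close>

lemma ns_add_ball:
  "x \<in> star_set (ball 0 r) \<Longrightarrow> y \<in> star_set (ball 0 s) \<Longrightarrow> ns_add N x y \<in> star_set (ball 0 (r + s))"
  by (erule ns_add_star_set) (auto intro: norm_triangle_lt)

lemma ns_uminus_ball: "x \<in> star_set (ball 0 r) \<Longrightarrow> ns_op N uminus x \<in> star_set (ball 0 r)"
proof -
  have "uminus -` ball (0::'a) r = ball 0 r" by auto
  then show "x \<in> star_set (ball 0 r) \<Longrightarrow> ns_op N uminus x \<in> star_set (ball 0 r)"
    by (simp add: ns_op_star_set_iff star_set_space)
qed

lemma ns_add_fin: "x \<in> ns_fin N \<Longrightarrow> y \<in> ns_fin N \<Longrightarrow> ns_add N x y \<in> ns_fin N"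
  unfolding ns_fin_iff using ns_add_ball by blast

lemma ns_uminus_fin: "x \<in> ns_fin N \<Longrightarrow> ns_op N uminus x \<in> ns_fin N"
  unfolding ns_fin_iff using ns_uminus_ball by blast

lemma carrier_fin_group [simp]: "carrier (fin_group N) = ns_fin N"
  and mult_fin_group [simp]: "monoid.mult (fin_group N) = ns_add N"
  and one_fin_group [simp]: "one (fin_group N) = emb 0"
  by (simp_all add: fin_group_def)

sublocale fin_group: comm_group "fin_group N"
proof (rule comm_groupI; simp)
  fix x
  assume "x \<in> ns_fin N"
  then show "\<exists>y\<in>ns_fin N. ns_add N y x = emb 0"
    using ns_uminus_fin ns_add_minus ns_fin_space by blast
qed (auto simp: ns_add_assoc ns_add_zero ns_fin_space intro: ns_add_fin ns_add_commute emb_fin)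

lemma monad0_subgroup: "subgroup (monad0 N) (fin_group N)"
proof (rule fin_group.subgroupI)
  show "monad0 N \<subseteq> carrier (fin_group N)" using monad0_fin by auto
  have "emb 0 \<in> monad0 N" by (simp add: monad0_iff)
  then show "monad0 N \<noteq> {}" by blast
next
  fix a
  assume a: "a \<in> monad0 N"
  then have "inv\<^bsub>fin_group N\<^esub> a = ns_op N uminus a"
    by (intro fin_group.inv_equality) (simp_all add: ns_add_minus ns_fin_space ns_uminus_fin monad0_fin)
  then show "inv\<^bsub>fin_group N\<^esub> a \<in> monad0 N"
    using a ns_uminus_ball by (simp add: monad0_iff)
next
  fix a b
  assume "a \<in> monad0 N" "b \<in> monad0 N"
  then have "ns_add N a b \<in> star_set (ball 0 r)" if "0 < r" for r
    using ns_add_ball[of a "r / 2" b "r / 2"] that by (simp add: monad0_iff)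
  then show "a \<otimes>\<^bsub>fin_group N\<^esub> b \<in> monad0 N" by (simp add: monad0_iff)
qed

lemma monad0_normal: "monad0 N \<lhd> fin_group N"
  by (rule fin_group.subgroup_imp_normal[OF monad0_subgroup])

lemma hat_eq: "hat N x = {ns_add N h x | h. h \<in> monad0 N}"
  by (auto simp: hat_def r_coset_def)

lemma hat_add_monad0: "h \<in> monad0 N \<Longrightarrow> x \<in> ns_fin N \<Longrightarrow> hat N (ns_add N h x) = hat N x"
  unfolding hat_def
  by (rule fin_group.repr_independence[OF _ _ monad0_subgroup, symmetric]) (auto simp: r_coset_def)

lemma hat_add:
  "x \<in> ns_fin N \<Longrightarrow> y \<in> ns_fin N \<Longrightarrow> hat N x \<otimes>\<^bsub>ns_hull N\<^esub> hat N y = hat N (ns_add N x y)"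
  using normal.rcos_sum[OF monad0_normal, of x y] by (simp add: hat_def ns_hull_def)

lemma carrier_ns_hull: "carrier (ns_hull N) = hat N ` ns_fin N"
  by (simp add: ns_hull_def carrier_FactGroup hat_def)

lemma one_ns_hull: "one (ns_hull N) = hat N (emb 0)"
  using fin_group.coset_mult_one[of "monad0 N"] monad0_fin by (auto simp: ns_hull_def hat_def)

sublocale ns_hull: comm_group "ns_hull N"
  unfolding ns_hull_def by (rule fin_group.abelian_FactGroup[OF monad0_subgroup])

lemma hat_self: "x \<in> ns_fin N \<Longrightarrow> x \<in> hat N x"
  unfolding hat_def by (rule fin_group.rcos_self[OF _ monad0_subgroup]) simp

lemma std_norm_add_monad0:
  assumes "h \<in> monad0 N" "x \<in> ns_fin N"
  shows "std_norm (ns_add N h x) \<le> std_norm x"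
proof (rule field_le_epsilon)
  fix e :: real
  assume e: "0 < e"
  have "ns_add N h x \<in> star_set (ball 0 (e / 2 + (std_norm x + e / 2)))"
  proof (rule ns_add_ball)
    show "h \<in> star_set (ball 0 (e / 2))" using assms(1) e by (simp add: monad0_iff)
    show "x \<in> star_set (ball 0 (std_norm x + e / 2))" using assms(2) e by (simp add: std_norm_less)
  qed
  then show "std_norm (ns_add N h x) \<le> std_norm x + e"
    using std_norm_le by (fastforce simp: add.commute)
qed

text \<open>\<open>the_elem\<close> is meaningful because an infinitesimal shift does not change the
  standard part of the norm.\<close>

lemma hull_norm_hat:
  assumes x: "x \<in> ns_fin N"
  shows "hull_norm N (hat N x) = std_norm x"
proof -
  have "standard_part N (ns_norm N y) = standard_part N (ns_norm N x)" if y_hat: "y \<in> hat N x" for y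
  proof -
    obtain h where h: "h \<in> monad0 N" and y: "y = ns_add N h x" using y_hat hat_eq by blast
    have y_fin: "y \<in> ns_fin N" using h x y by (simp add: ns_add_fin monad0_fin)
    \<comment> \<open>Undoing the shift by the opposite infinitesimal gives the reverse
      inequality.\<close>
    have h': "ns_op N uminus h \<in> monad0 N" using h ns_uminus_ball by (simp add: monad0_iff)
    have "ns_add N (ns_op N uminus h) y = x"
      using ns_add_assoc[of "ns_op N uminus h" h x] h x h'
      by (simp add: y ns_add_minus ns_add_zero ns_fin_space monad0_fin)
    then have "std_norm x \<le> std_norm y" using std_norm_add_monad0[OF h' y_fin] by simp
    moreover have "std_norm y \<le> std_norm x" using std_norm_add_monad0[OF h x] by (simp add: y)
    ultimately show ?thesis by (simp add: standard_part_ns_norm x y_fin)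
  qed
  with hat_self[OF x] show ?thesis
    unfolding hull_norm_def standard_part_ns_norm[OF x, symmetric]
    by (intro the_elem_image_unique) blast+
qed

section \<open>The quotient of the hull by the space\<close>

lemma std_copy_subgroup: "subgroup (std_copy N) (ns_hull N)"
proof (rule ns_hull.subgroupI)
  show "std_copy N \<subseteq> carrier (ns_hull N)"
    using emb_fin by (auto simp: std_copy_def carrier_ns_hull)
  show "std_copy N \<noteq> {}" by (simp add: std_copy_def)
next
  fix a
  assume "a \<in> std_copy N"
  then obtain v where a: "a = hat N (emb v)" by (auto simp: std_copy_def)
  have "inv\<^bsub>ns_hull N\<^esub> a = hat N (emb (- v))"
    unfolding a
    by (rule ns_hull.inv_equality) (simp_all add: hat_add emb_fin ns_add_emb_emb one_ns_hull carrier_ns_hull)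
  then show "inv\<^bsub>ns_hull N\<^esub> a \<in> std_copy N" by (simp add: std_copy_def)
next
  fix a b
  assume "a \<in> std_copy N" "b \<in> std_copy N"
  then show "a \<otimes>\<^bsub>ns_hull N\<^esub> b \<in> std_copy N"
    by (auto simp: std_copy_def hat_add emb_fin ns_add_emb_emb)
qed

definition tilde :: "'s \<Rightarrow> 's set set" where
  "tilde x = std_copy N #>\<^bsub>ns_hull N\<^esub> hat N x"

lemma carrier_hull_quot: "carrier (hull_quot N) = tilde ` ns_fin N"
  by (auto simp: hull_quot_def carrier_FactGroup carrier_ns_hull tilde_def)

lemma tilde_eq:
  assumes "x \<in> ns_fin N"
  shows "tilde x = range (\<lambda>v. hat N (ns_add N (emb v) x))"
  by (auto simp: tilde_def r_coset_def std_copy_def hat_add emb_fin assms)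

lemma tilde_add_emb:
  assumes "x \<in> ns_fin N"
  shows "tilde (ns_add N (emb v) x) = tilde x"
proof -
  have "hat N (ns_add N (emb v) x) \<in> tilde x" using tilde_eq[OF assms] by blast
  then show ?thesis
    unfolding tilde_def
    by (intro ns_hull.repr_independence[OF _ _ std_copy_subgroup, symmetric])
      (auto simp: carrier_ns_hull assms)
qed

text \<open>The right side is the distance of \<open>x\<close> from the standard vectors, with
  \<open>- v\<close> as the approximating vector.\<close>

lemma quot_norm_tilde:
  assumes "x \<in> ns_fin N"
  shows "quot_norm N (tilde x) = (INF v. std_norm (ns_add N (emb v) x))"
  by (simp add: quot_norm_def tilde_eq assms image_image hull_norm_hat ns_add_fin emb_fin)

lemma std_norm_add_emb_nonneg: "x \<in> ns_fin N \<Longrightarrow> 0 \<le> std_norm (ns_add N (emb v) x)"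
  by (simp add: std_norm_nonneg ns_add_fin emb_fin)

lemma quot_norm_tilde_nonneg: "x \<in> ns_fin N \<Longrightarrow> 0 \<le> quot_norm N (tilde x)"
  using std_norm_add_emb_nonneg by (auto simp: quot_norm_tilde intro!: cINF_greatest)

lemma quot_norm_tilde_le:
  assumes "x \<in> ns_fin N" "ns_add N (emb v) x \<in> star_set (ball 0 r)"
  shows "quot_norm N (tilde x) \<le> r"
proof -
  have "quot_norm N (tilde x) \<le> std_norm (ns_add N (emb v) x)"
    unfolding quot_norm_tilde[OF assms(1)]
    by (intro cINF_lower bdd_belowI2[of _ 0] std_norm_add_emb_nonneg assms) simp
  then show ?thesis using std_norm_le[OF assms(2)] by simp
qed

text \<open>The bound is strict because the infimum over standard translates need not be
  attained.\<close>

lemma quot_norm_tilde_less: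
  assumes "x \<in> ns_fin N" "quot_norm N (tilde x) < r"
  obtains v where "ns_add N (emb v) x \<in> star_set (ball 0 r)"
proof -
  obtain v where "std_norm (ns_add N (emb v) x) < r"
    using cInf_lessD[OF _ assms(2)[unfolded quot_norm_tilde[OF assms(1)]]] by auto
  then show thesis using that std_norm_less ns_add_fin[OF emb_fin assms(1)] by blast
qed

end

section \<open>The operators induced by a bounded linear map\<close>

locale bounded_operator_on_hull = nonstandard_hull N
  for N :: "('a::real_normed_vector + real, 's) universe" +
  fixes T :: "'a \<Rightarrow> 'a"
  assumes bounded_linear: "bounded_linear T"
begin

text \<open>Transfer of the norm bound; with one \<open>K\<close> for all radii, \<open>T\<close>
  preserves both finite and infinitesimal points.\<close>

lemma ns_op_ball:
  obtains K where "0 < K" "\<And>x r. x \<in> star_set (ball 0 r) \<Longrightarrow> ns_op N T x \<in> star_set (ball 0 (r * K))"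
proof -
  obtain K where K: "0 < K" "\<And>v. norm (T v) \<le> norm v * K"
    using bounded_linear.pos_bounded[OF bounded_linear] by blast
  have "ball 0 r \<subseteq> T -` ball 0 (r * K)" for r
  proof
    fix v :: 'a
    assume "v \<in> ball 0 r"
    then have "norm v * K < r * K" using K(1) by simp
    then show "v \<in> T -` ball 0 (r * K)" using K(2)[of v] by simp
  qed
  then have "ns_op N T x \<in> star_set (ball 0 (r * K))" if "x \<in> star_set (ball 0 r)" for x r
    using that star_set_mono[of "ball 0 r" "T -` ball 0 (r * K)"]
    by (simp add: ns_op_star_set_iff star_set_space subset_iff)
  with K(1) show thesis by (rule that)
qed

lemma ns_op_fin: "x \<in> ns_fin N \<Longrightarrow> ns_op N T x \<in> ns_fin N"
  unfolding ns_fin_iff by (metis ns_op_ball)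

lemma ns_op_monad0:
  assumes "x \<in> monad0 N"
  shows "ns_op N T x \<in> monad0 N"
proof -
  obtain K where K: "0 < K" "\<And>x r. x \<in> star_set (ball 0 r) \<Longrightarrow> ns_op N T x \<in> star_set (ball 0 (r * K))"
    using ns_op_ball by blast
  have "ns_op N T x \<in> star_set (ball 0 r)" if "0 < r" for r
    using K(2)[of x "r / K"] assms that K(1) by (simp add: monad0_iff)
  then show ?thesis by (simp add: monad0_iff)
qed

lemma ns_op_ns_add:
  "x \<in> ns_space N \<Longrightarrow> y \<in> ns_space N \<Longrightarrow> ns_op N T (ns_add N x y) = ns_add N (ns_op N T x) (ns_op N T y)"
  by (rule ns_op_add) (rule linear_simps(1)[OF bounded_linear])

text \<open>Changing the representative by an infinitesimal changes the image by an infinitesimal,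
  which \<open>hat\<close> absorbs.\<close>

lemma hull_op_hat:
  assumes x: "x \<in> ns_fin N"
  shows "hull_op N T (hat N x) = hat N (ns_op N T x)"
proof -
  have "hat N (ns_op N T y) = hat N (ns_op N T x)" if y_hat: "y \<in> hat N x" for y
  proof -
    obtain h where h: "h \<in> monad0 N" and y: "y = ns_add N h x" using y_hat hat_eq by blast
    then show ?thesis
      by (simp add: ns_op_ns_add hat_add_monad0 ns_op_monad0 ns_op_fin ns_fin_space monad0_fin x)
  qed
  with hat_self[OF x] show ?thesis
    unfolding hull_op_def by (intro the_elem_image_unique) blast+
qed

text \<open>Translating \<open>x\<close> by a standard \<open>v\<close> translates the image by the
  standard vector \<open>T v\<close>, which \<open>tilde\<close> absorbs.\<close>

lemma quot_op_tilde:
  assumes x: "x \<in> ns_fin N"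
  shows "quot_op N T (tilde x) = tilde (ns_op N T x)"
proof -
  have "std_copy N #>\<^bsub>ns_hull N\<^esub> hull_op N T (hat N (ns_add N (emb v) x)) = tilde (ns_op N T x)" for v
    using tilde_add_emb[OF ns_op_fin[OF x], of "T v"]
    by (simp add: hull_op_hat ns_add_fin emb_fin x ns_op_ns_add ns_fin_space ns_op_emb tilde_def)
  then show ?thesis
    unfolding quot_op_def tilde_eq[OF x] image_image by simp
qed

lemma quot_norm_quot_op_le:
  assumes C: "finite C" "T ` cball 0 1 \<subseteq> (\<Union>c\<in>C. cball c \<delta>)" and "0 < \<delta>"
    and x: "x \<in> ns_fin N" "quot_norm N (tilde x) \<le> 1"
  shows "quot_norm N (quot_op N T (tilde x)) \<le> \<delta>"
proof (rule dense_ge)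
  fix r
  assume r: "\<delta> < r"
  \<comment> \<open>The midpoint of 1 and \<open>r / \<delta>\<close>. A class of norm at most 1
    only has representatives of norm below any \<open>s > 1\<close>, so the cover is scaled by
    \<open>s\<close>, at a cost that stays below \<open>r\<close>.\<close>
  define s where "s = (1 + r / \<delta>) / 2"
  have s: "1 < s" "s * \<delta> < r"
    using r \<open>0 < \<delta>\<close> by (simp_all add: s_def field_simps)
  obtain v where v: "ns_add N (emb v) x \<in> star_set (ball 0 s)"
    using quot_norm_tilde_less[of x s] x s by auto
  define y where "y = ns_add N (emb v) x"
  have y: "y \<in> ns_fin N" "tilde y = tilde x"
    by (simp_all add: y_def ns_add_fin emb_fin tilde_add_emb x)
  have "ball 0 s \<subseteq> T -` (\<Union>c\<in>C. cball (s *\<^sub>R c) (s * \<delta>))"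
  proof
    fix u :: 'a
    assume "u \<in> ball 0 s"
    then have "T (u /\<^sub>R s) \<in> T ` cball 0 1" using s by (intro imageI) (simp add: field_simps)
    then obtain c where c: "c \<in> C" "norm (c - T (u /\<^sub>R s)) \<le> \<delta>"
      using C(2) unfolding dist_norm[symmetric] mem_cball[symmetric] by blast
    have "s *\<^sub>R c - T u = s *\<^sub>R (c - T (u /\<^sub>R s))"
      using s by (simp add: linear_simps(5)[OF bounded_linear] algebra_simps)
    then have "norm (s *\<^sub>R c - T u) \<le> s * \<delta>" using c s by simp
    then show "u \<in> T -` (\<Union>c\<in>C. cball (s *\<^sub>R c) (s * \<delta>))"
      using c(1) by (auto simp: dist_norm)
  qed
  from subsetD[OF star_set_mono[OF this] v[folded y_def]]
  have "ns_op N T y \<in> star_set (\<Union>c\<in>C. cball (s *\<^sub>R c) (s * \<delta>))"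
    by (simp only: ns_op_star_set_iff[OF ns_fin_space[OF y(1)]])
  \<comment> \<open>Finiteness of \<open>C\<close> gives one standard centre for the nonstandard
    point \<open>ns_op N T y\<close>.\<close>
  then obtain c where c: "ns_op N T y \<in> star_set (cball (s *\<^sub>R c) (s * \<delta>))"
    using star_set_UN[OF C(1)] by blast
  have "cball (s *\<^sub>R c) (s * \<delta>) \<subseteq> (\<lambda>u. - (s *\<^sub>R c) + u) -` ball 0 r"
    using s by (auto simp: dist_norm norm_minus_commute)
  then have "ns_add N (emb (- (s *\<^sub>R c))) (ns_op N T y) \<in> star_set (ball 0 r)"
    using c star_set_mono ns_fin_space[OF ns_op_fin[OF y(1)]]
    by (auto simp: ns_add_emb ns_op_star_set_iff)
  then have "quot_norm N (tilde (ns_op N T y)) \<le> r"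
    using quot_norm_tilde_le ns_op_fin y by blast
  then show "quot_norm N (quot_op N T (tilde x)) \<le> r"
    using y quot_op_tilde by metis
qed

text \<open>No finite set of centres suffices, so by saturation one point of the extended unit ball
  escapes the balls about all standard centres simultaneously.\<close>

lemma quot_norm_quot_op_ge:
  assumes "\<And>C. finite C \<Longrightarrow> \<not> T ` cball 0 1 \<subseteq> (\<Union>c\<in>C. cball c \<delta>)"
  obtains x where "x \<in> ns_fin N" "quot_norm N (tilde x) \<le> 1" "\<delta> \<le> quot_norm N (quot_op N T (tilde x))"
proof -
  let ?A = "\<lambda>c. {v \<in> cball 0 1. T v \<notin> cball c \<delta>}"
  have "(\<Inter>c\<in>C. ?A c) \<noteq> {}" if "finite C" for C
    using assms[OF that] by auto
  from saturation[of ?A, OF this] obtain x where x: "\<And>c. x \<in> star_set (?A c)" by blast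
  have ball: "x \<in> star_set (ball 0 r)" if "1 < r" for r
  proof -
    have "?A 0 \<subseteq> ball 0 r" using that by auto
    from star_set_mono[OF this] x[of 0] show ?thesis by blast
  qed
  have fin: "x \<in> ns_fin N" using ball[of 2] by (auto simp: ns_fin_iff)
  have "quot_norm N (tilde x) \<le> 1"
    by (rule dense_ge, rule quot_norm_tilde_le[OF fin, of 0])
      (simp add: ns_add_zero ns_fin_space[OF fin] ball)
  moreover have "\<delta> \<le> quot_norm N (tilde (ns_op N T x))"
  proof (rule ccontr)
    assume "\<not> ?thesis"
    then obtain v where "ns_add N (emb v) (ns_op N T x) \<in> star_set (ball 0 \<delta>)"
      using quot_norm_tilde_less[OF ns_op_fin[OF fin], of \<delta>] by auto
    \<comment> \<open>Closeness of the image to \<open>- v\<close> is pulled back to a standard set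
      of arguments, which is disjoint from the set of points escaping the ball about
      \<open>- v\<close>.\<close>
    then have "x \<in> star_set (T -` (\<lambda>u. v + u) -` ball 0 \<delta>)"
      by (simp add: ns_add_emb ns_op_star_set_iff ns_op_closed ns_fin_space[OF fin])
    moreover have "?A (- v) \<inter> (T -` (\<lambda>u. v + u) -` ball 0 \<delta>) = {}"
      by (auto simp: dist_norm norm_minus_commute add.commute)
    ultimately show False using star_set_disjoint x by blast
  qed
  ultimately show thesis using that fin quot_op_tilde by simp
qed

lemma op_noncompactness_eq: "op_noncompactness T = quot_opnorm N (quot_op N T)"
proof -
  define D where "D = {\<delta>. \<delta> > 0 \<and> (\<exists>C. finite C \<and> T ` cball 0 1 \<subseteq> (\<Union>c\<in>C. cball c \<delta>))}"
  define U where "U = {c \<in> carrier (hull_quot N). quot_norm N c \<le> 1}"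
  obtain K where K: "0 < K" "\<And>v. norm (T v) \<le> norm v * K"
    using bounded_linear.pos_bounded[OF bounded_linear] by blast
  have "norm (T v) \<le> K" if "norm v \<le> 1" for v
    by (rule order_trans[OF K(2)]) (use K(1) that in simp)
  then have "T ` cball 0 1 \<subseteq> (\<Union>c\<in>{0}. cball c K)" by auto
  \<comment> \<open>This makes \<open>D\<close> nonempty and bounds the set under the
    supremum.\<close>
  with K(1) have K_D: "K \<in> D" unfolding D_def by blast
  have le: "quot_norm N (quot_op N T c) \<le> \<delta>" if "\<delta> \<in> D" "c \<in> U" for c \<delta>
    using that quot_norm_quot_op_le by (auto simp: D_def U_def carrier_hull_quot)
  have upper: "quot_norm N (quot_op N T c) \<le> (SUP c\<in>U. quot_norm N (quot_op N T c))" if "c \<in> U" for c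
    using that K_D le by (intro cSUP_upper bdd_aboveI2[of _ _ K])
  \<comment> \<open>The zero class makes \<open>U\<close> nonempty and, below, forces the supremum
    to be nonnegative.\<close>
  have zero: "tilde (emb 0) \<in> U"
  proof -
    have "quot_norm N (tilde (emb 0)) \<le> 1"
      by (rule quot_norm_tilde_le[of _ 0]) (simp_all add: emb_fin ns_add_emb_emb)
    then show ?thesis by (simp add: U_def carrier_hull_quot emb_fin)
  qed
  have nonneg: "0 \<le> (SUP c\<in>U. quot_norm N (quot_op N T c))"
    using upper[OF zero] quot_norm_tilde_nonneg[OF ns_op_fin[OF emb_fin[of 0]]]
    by (simp add: quot_op_tilde emb_fin)
  have "Inf D = (SUP c\<in>U. quot_norm N (quot_op N T c))"
  proof (rule antisym)
    show "(SUP c\<in>U. quot_norm N (quot_op N T c)) \<le> Inf D"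
      using zero K_D le by (intro cSUP_least cInf_greatest) auto
    show "Inf D \<le> (SUP c\<in>U. quot_norm N (quot_op N T c))"
    proof (rule dense_ge)
      fix r
      assume r: "(SUP c\<in>U. quot_norm N (quot_op N T c)) < r"
      \<comment> \<open>Since the supremum is nonnegative, \<open>r\<close> is positive, so
        \<open>r\<close> can only fail to lie in \<open>D\<close> for want of a finite cover; the
        point found then would push the supremum up to \<open>r\<close>.\<close>
      have "r \<in> D"
      proof (rule ccontr)
        assume "r \<notin> D"
        then have "\<not> T ` cball 0 1 \<subseteq> (\<Union>c\<in>C. cball c r)" if "finite C" for C
          using that r nonneg by (auto simp: D_def)
        then obtain x where "x \<in> ns_fin N" "quot_norm N (tilde x) \<le> 1"
            "r \<le> quot_norm N (quot_op N T (tilde x))"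
          using quot_norm_quot_op_ge by blast
        then show False using upper[of "tilde x"] r by (simp add: U_def carrier_hull_quot)
      qed
      then show "Inf D \<le> r"
        by (intro cInf_lower bdd_belowI[of _ 0]) (auto simp: D_def)
    qed
  qed
  then show ?thesis
    by (simp add: op_noncompactness_def noncompactness_def quot_opnorm_def D_def U_def)
qed

end

theorem corollary3:
  fixes N :: "('a::banach + real, 's) universe"
    and T :: "'a \<Rightarrow> 'a"
  assumes "saturated_nonstandard_universe N"
    and "bounded_linear T"
  shows "op_noncompactness T = quot_opnorm N (quot_op N T)"
proof -
  interpret bounded_operator_on_hull N T
    using assms by (intro bounded_operator_on_hull.intro nonstandard_hull.intro bounded_operator_on_hull_axioms.intro)
  show ?thesis by (rule op_noncompactness_eq)
qed

end
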